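(* Let $\{U^n_h\}_{n=0}^N$ be the fine-grid solution produced by Algorithm 4.1 (described in the context). If $$\Delta t\le\min\left\{\frac12,\frac{7\nu_0^2}{8\mu_0^2K_1^2T}\right\}\quad\text{and}\quad \Delta t\le\min\left\{\frac12,\frac{3\nu_0^2}{2\mu_1^2K_1^2T}\right\},$$ then, for $1\le n\le N$, $$\sup_{1\le i\le n}\|U^i_h\|+\Big(\sum_{i=1}^n\|U^i_h-U^{i-1}_h\|^2\Big)^{1/2}+\frac{\sqrt{\nu_0}}{2}\Big(\sum_{i=1}^n\Delta t\,\|U^i_h\|_1^2\Big)^{1/2}\le C\Big(\|U^0_h\|^2+\|U^0_H\|^2+\Delta t\sum_{i=1}^n\|f^i\|^2\Big)^{1/2},$$ where $C>0$ is a constant independent of $h$, $H$, $\Delta t$ and $n$.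
   Context: Setting. $\Omega\subset\mathbb R^d$ ($d\ge1$) is a bounded polyhedral domain with piecewise smooth boundary, $T>0$, $\mathcal H^1_0=\mathcal H^1_0(\Omega)$; $(\cdot,\cdot)$ and $\|\cdot\|$ are the $L^2(\Omega)$ inner product and norm, $\|\cdot\|_1$ is the $\mathcal H^1(\Omega)$ norm. The problem is $u_t+Au+\int_0^tK(t-s)Bu(s)\,ds=f$ in $\Omega\times(0,T]$, $u=0$ on $\partial\Omega\times(0,T]$, $u(\cdot,0)=u_0$, with $K$ a (smooth or nonsmooth) memory kernel, $f$ known, $A$ a symmetric positive definite second-order elliptic operator with coefficients smooth in $x$ and $t$, and $Bu=-\nabla\cdot(\alpha(u)\nabla u+\beta(u))+\gamma(u)\cdot\nabla u+g(u)$, where $\alpha(x,u)\in\mathbb R^{d\times d}$, $\beta(x,u),\gamma(x,u)\in\mathbb R^d$, $g(x,u)\in\mathbb R$ (dependence on $x$ suppressed) are smooth and bounded together with their derivatives, and $\beta(0)=0$, $g(0)=0$. $A(\cdot,\cdot)$ is the bilinear form of $A$ on $\mathcal H^1_0\times \mathcal H^1_0$ (possible $t$-dependence suppressed), with $A(v,v)\ge\nu_0\|v\|_1^2$ and $|A(u,v)|\le\nu_1\|u\|_1\|v\|_1$. Set $\tilde B(w;u,v)=(\alpha(w)\nabla u+\beta(w),\nabla v)+(\gamma(w)\cdot\nabla u+g(w),v)$ and $B(u,v)=\tilde B(u;u,v)$. The constants $\mu_0,\mu_1,\mu_2>0$ (which exist by the assumptions on the coefficients) satisfy $|B(u,v)|\le\mu_0\|u\|_1\|v\|_1$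 and $|\tilde B(w;u,v)|\le\mu_1\|u\|_1\|v\|_1+\mu_2\|w\|\|v\|_1$. Spaces. $\{S_h\}_{0<h\le1}$ are finite-dimensional subspaces of $\mathcal H^1_0$ with $\inf_{\chi\in S_h}\{\|v-\chi\|+h\|v-\chi\|_1\}\le C h^r\|v\|_r$ for $v\in \mathcal H^r\cap \mathcal H^1_0$ ($r\ge1+\frac d2$), and $\|\nabla\chi\|_\infty\le Ch^{-d/2}\|\nabla\chi\|$ for $\chi\in S_h$, with $C$ independent of $h$. $S_H$ (coarse, mesh size $H$) and $S_h$ (fine, mesh size $h\ll H$) are two members of this family, built on triangulations $\mathcal T_H$ and $\mathcal T_h$ of $\Omega$. Time discretization. $N$ is a positive integer, $\Delta t=T/N$, $t_n=n\Delta t$, $f^n=f(t_n)$. The weights $\omega_{ni}$ of the quadrature $\Delta t\sum_{i=1}^n\omega_{ni}\phi(t_i)=\int_0^{t_n}K(t_n-s)\phi(s)\,ds+O(\Delta t)$ satisfy $|\omega_{ni}|\le K_1$ for $1\le i\le n\le N$ and $\omega_{nn}\ne0$. Algorithm 4.1. Step one (coarse grid): $U^0_H=u^0_H\in S_H$ (an approximation of $u_0$), and for $1\le n\le N$ find $U^n_H\in S_H$ with $\frac1{\Delta t}(U^n_H-U^{n-1}_H,v)+A(U^n_H,v)+\Delta t\sum_{i=1}^n\omega_{ni}\tilde B(U^i_H;U^i_H,v)=(f^n,v)$ for all $v\in S_H$. Step two (fine grid): $U^0_h=u^0_h\in S_h$ (an approximation of $u_0$), and for $1\le n\le N$ find $U^n_h\in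 S_h$ with $\frac1{\Delta t}(U^n_h-U^{n-1}_h,v)+A(U^n_h,v)+\Delta t\sum_{i=1}^n\omega_{ni}\tilde B(U^i_H;U^i_h,v)=(f^n,v)$ for all $v\in S_h$.
   Formalization: For a single time step (N = 1, so Δt = T) the additional condition μ₁K₁Δt < ν₀ is assumed, because without it the implicit fine-grid problem can be singular and the estimate false; for N ≥ 2 nothing is added. *)

theory Defs
  imports "HOL-Analysis.Analysis"
begin

section \<open>Smooth functions\<close>

definition partial_deriv ::
  "'a::euclidean_space \<Rightarrow> ('a \<Rightarrow> 'b::real_normed_vector) \<Rightarrow> 'a \<Rightarrow> 'b" where
  "partial_deriv b f x = frechet_derivative f (at x) b"

abbreviation iter_deriv ::
  "'a::euclidean_space list \<Rightarrow> ('a \<Rightarrow> 'b::real_normed_vector) \<Rightarrow> 'a \<Rightarrow> 'b" where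
  "iter_deriv bs f \<equiv> foldr partial_deriv bs f"

text \<open>Differentiability of all iterated partial derivatives makes all of them continuous, so
  this is \<open>C\<^sup>\<infinity>\<close> on an open neighbourhood of \<open>S\<close>; if \<open>S\<close> is open, \<open>V = S\<close> will do.\<close>

definition smooth_on ::
  "'a::euclidean_space set \<Rightarrow> ('a \<Rightarrow> 'b::real_normed_vector) \<Rightarrow> bool" where
  "smooth_on S f \<longleftrightarrow>
     (\<exists>V. open V \<and> S \<subseteq> V \<and>
        (\<forall>bs. set bs \<subseteq> Basis \<longrightarrow> (\<forall>x\<in>V. iter_deriv bs f differentiable (at x))))"

definition smooth_bounded_on ::
  "'a::euclidean_space set \<Rightarrow> ('a \<Rightarrow> 'b::real_normed_vector) \<Rightarrow> bool" where
  "smooth_bounded_on S f \<longleftrightarrow>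
     smooth_on S f \<and> (\<forall>bs. set bs \<subseteq> Basis \<longrightarrow> bounded (iter_deriv bs f ` S))"

section \<open>Lebesgue and Sobolev spaces\<close>

text \<open>Elements of the function spaces are represented by functions on the whole of
  \<open>real ^ 'n\<close>, of which only the values almost everywhere on \<open>\<Omega>\<close> matter.\<close>

definition L2 :: "(real ^ 'n) set \<Rightarrow> (real ^ 'n \<Rightarrow> real) set" where
  "L2 \<Omega> = {u. u \<in> borel_measurable (lebesgue_on \<Omega>) \<and>
                integrable (lebesgue_on \<Omega>) (\<lambda>x. (u x)\<^sup>2)}"

definition l2_inner ::
  "(real ^ 'n) set \<Rightarrow> (real ^ 'n \<Rightarrow> 'b::real_inner) \<Rightarrow> (real ^ 'n \<Rightarrow> 'b) \<Rightarrow> real" where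
  "l2_inner \<Omega> u v = (LINT x|lebesgue_on \<Omega>. u x \<bullet> v x)"

definition l2_norm :: "(real ^ 'n) set \<Rightarrow> (real ^ 'n \<Rightarrow> 'b::real_inner) \<Rightarrow> real" where
  "l2_norm \<Omega> u = sqrt (l2_inner \<Omega> u u)"

definition test_functions :: "(real ^ 'n) set \<Rightarrow> (real ^ 'n \<Rightarrow> real) set" where
  "test_functions \<Omega> = {\<phi>. smooth_on UNIV \<phi> \<and>
     compact (closure {x. \<phi> x \<noteq> 0}) \<and> closure {x. \<phi> x \<noteq> 0} \<subseteq> \<Omega>}"

text \<open>Multi-indices are functions \<open>m :: 'n \<Rightarrow> nat\<close>. A list \<open>js\<close> of coordinates with
  \<open>count_list js = m\<close> is an order in which the derivatives making up \<open>D\<^sup>m\<close> are taken.\<close>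

abbreviation mi_order :: "('n::finite \<Rightarrow> nat) \<Rightarrow> nat" where
  "mi_order m \<equiv> (\<Sum>j\<in>UNIV. m j)"

definition weak_deriv ::
  "(real ^ 'n) set \<Rightarrow> ('n \<Rightarrow> nat) \<Rightarrow> (real ^ 'n \<Rightarrow> real) \<Rightarrow> (real ^ 'n \<Rightarrow> real) \<Rightarrow> bool" where
  "weak_deriv \<Omega> m u w \<longleftrightarrow>
     (\<forall>\<phi>\<in>test_functions \<Omega>. \<forall>js. count_list js = m \<longrightarrow>
        (LINT x|lebesgue_on \<Omega>. u x * iter_deriv (map (\<lambda>j. axis j 1) js) \<phi> x) =
        (-1) ^ mi_order m * (LINT x|lebesgue_on \<Omega>. w x * \<phi> x))"

text \<open>The weak derivative \<open>D\<^sup>m u\<close>, unique up to null sets. Meaningful only if it exists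
  in \<open>L2 \<Omega>\<close>.\<close>

definition Dw ::
  "(real ^ 'n) set \<Rightarrow> ('n \<Rightarrow> nat) \<Rightarrow> (real ^ 'n \<Rightarrow> real) \<Rightarrow> real ^ 'n \<Rightarrow> real" where
  "Dw \<Omega> m u = (if m = (\<lambda>_. 0) then u else (SOME w. w \<in> L2 \<Omega> \<and> weak_deriv \<Omega> m u w))"

definition grad :: "(real ^ 'n) set \<Rightarrow> (real ^ 'n \<Rightarrow> real) \<Rightarrow> real ^ 'n \<Rightarrow> real ^ 'n" where
  "grad \<Omega> u x = (\<chi> i. Dw \<Omega> (\<lambda>j. if j = i then 1 else 0) u x)"

text \<open>For fractional order \<open>r = k + s\<close> the Sobolev space is the Sobolev-Slobodeckij space:
  \<open>gagliardo s v\<close> is the integrand of the squared seminorm of order \<open>s\<close>.\<close>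

definition gagliardo ::
  "real \<Rightarrow> (real ^ 'n \<Rightarrow> real) \<Rightarrow> (real ^ 'n) \<times> (real ^ 'n) \<Rightarrow> real" where
  "gagliardo s v = (\<lambda>(x, y). (v x - v y)\<^sup>2 / norm (x - y) powr (real CARD('n) + 2 * s))"

definition sobolev :: "(real ^ 'n) set \<Rightarrow> real \<Rightarrow> (real ^ 'n \<Rightarrow> real) set" where
  "sobolev \<Omega> r = {u \<in> L2 \<Omega>.
     (\<forall>m. mi_order m \<le> nat \<lfloor>r\<rfloor> \<longrightarrow> (\<exists>w\<in>L2 \<Omega>. weak_deriv \<Omega> m u w)) \<and>
     (frac r \<noteq> 0 \<longrightarrow> (\<forall>m. mi_order m = nat \<lfloor>r\<rfloor> \<longrightarrow>
        integrable (lebesgue_on \<Omega> \<Otimes>\<^sub>M lebesgue_on \<Omega>) (gagliardo (frac r) (Dw \<Omega> m u))))}"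

definition sobolev_norm :: "(real ^ 'n) set \<Rightarrow> real \<Rightarrow> (real ^ 'n \<Rightarrow> real) \<Rightarrow> real" where
  "sobolev_norm \<Omega> r u = sqrt (
     (\<Sum>m | mi_order m \<le> nat \<lfloor>r\<rfloor>. (l2_norm \<Omega> (Dw \<Omega> m u))\<^sup>2) +
     (if frac r = 0 then 0 else
       (\<Sum>m | mi_order m = nat \<lfloor>r\<rfloor>.
          (\<integral>z. gagliardo (frac r) (Dw \<Omega> m u) z \<partial>(lebesgue_on \<Omega> \<Otimes>\<^sub>M lebesgue_on \<Omega>)))))"

abbreviation h1_norm :: "(real ^ 'n) set \<Rightarrow> (real ^ 'n \<Rightarrow> real) \<Rightarrow> real" where
  "h1_norm \<Omega> \<equiv> sobolev_norm \<Omega> 1"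

definition H10 :: "(real ^ 'n) set \<Rightarrow> (real ^ 'n \<Rightarrow> real) set" where
  "H10 \<Omega> = {u \<in> sobolev \<Omega> 1. \<exists>\<phi>. (\<forall>k::nat. \<phi> k \<in> test_functions \<Omega>) \<and>
     (\<lambda>k. h1_norm \<Omega> (\<lambda>x. u x - \<phi> k x)) \<longlonglongrightarrow> 0}"

section \<open>The continuous problem\<close>

text \<open>Such a set is open and bounded, and its boundary lies in finitely many hyperplanes.\<close>

definition polyhedral_domain :: "(real ^ 'n) set \<Rightarrow> bool" where
  "polyhedral_domain \<Omega> \<longleftrightarrow> \<Omega> \<noteq> {} \<and> connected \<Omega> \<and>
     (\<exists>F. finite F \<and> (\<forall>P\<in>F. polytope P) \<and> \<Omega> = interior (\<Union>F))"

text \<open>The operator \<open>A u = - div (a \<nabla>u) + a\<^sub>0 u\<close>; formal symmetry leaves no first-order term.\<close>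

definition symmetric_elliptic ::
  "(real ^ 'n) set \<Rightarrow> real \<Rightarrow> (real ^ 'n \<Rightarrow> real \<Rightarrow> real ^ 'n ^ 'n) \<Rightarrow>
   (real ^ 'n \<Rightarrow> real \<Rightarrow> real) \<Rightarrow> bool" where
  "symmetric_elliptic \<Omega> T a a\<^sub>0 \<longleftrightarrow>
     smooth_on (closure \<Omega> \<times> {0..T}) (\<lambda>(x, t). a x t) \<and>
     smooth_on (closure \<Omega> \<times> {0..T}) (\<lambda>(x, t). a\<^sub>0 x t) \<and>
     (\<forall>x\<in>\<Omega>. \<forall>t\<in>{0..T}. transpose (a x t) = a x t) \<and>
     (\<exists>c>0. \<forall>x\<in>\<Omega>. \<forall>t\<in>{0..T}. \<forall>\<xi>. \<xi> \<bullet> (a x t *v \<xi>) \<ge> c * (norm \<xi>)\<^sup>2)"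

definition A_form ::
  "(real ^ 'n) set \<Rightarrow> (real ^ 'n \<Rightarrow> real \<Rightarrow> real ^ 'n ^ 'n) \<Rightarrow> (real ^ 'n \<Rightarrow> real \<Rightarrow> real) \<Rightarrow>
   real \<Rightarrow> (real ^ 'n \<Rightarrow> real) \<Rightarrow> (real ^ 'n \<Rightarrow> real) \<Rightarrow> real" where
  "A_form \<Omega> a a\<^sub>0 t u v =
     l2_inner \<Omega> (\<lambda>x. a x t *v grad \<Omega> u x) (grad \<Omega> v) + l2_inner \<Omega> (\<lambda>x. a\<^sub>0 x t * u x) v"

definition B_coefficients ::
  "(real ^ 'n) set \<Rightarrow> (real ^ 'n \<Rightarrow> real \<Rightarrow> real ^ 'n ^ 'n) \<Rightarrow> (real ^ 'n \<Rightarrow> real \<Rightarrow> real ^ 'n) \<Rightarrow>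
   (real ^ 'n \<Rightarrow> real \<Rightarrow> real ^ 'n) \<Rightarrow> (real ^ 'n \<Rightarrow> real \<Rightarrow> real) \<Rightarrow> bool" where
  "B_coefficients \<Omega> \<alpha> \<beta> \<gamma> g \<longleftrightarrow>
     smooth_bounded_on (\<Omega> \<times> UNIV) (\<lambda>(x, s). \<alpha> x s) \<and>
     smooth_bounded_on (\<Omega> \<times> UNIV) (\<lambda>(x, s). \<beta> x s) \<and>
     smooth_bounded_on (\<Omega> \<times> UNIV) (\<lambda>(x, s). \<gamma> x s) \<and>
     smooth_bounded_on (\<Omega> \<times> UNIV) (\<lambda>(x, s). g x s) \<and>
     (\<forall>x\<in>\<Omega>. \<beta> x 0 = 0 \<and> g x 0 = 0)"

definition Bt_form ::
  "(real ^ 'n) set \<Rightarrow> (real ^ 'n \<Rightarrow> real \<Rightarrow> real ^ 'n ^ 'n) \<Rightarrow> (real ^ 'n \<Rightarrow> real \<Rightarrow> real ^ 'n) \<Rightarrow>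
   (real ^ 'n \<Rightarrow> real \<Rightarrow> real ^ 'n) \<Rightarrow> (real ^ 'n \<Rightarrow> real \<Rightarrow> real) \<Rightarrow>
   (real ^ 'n \<Rightarrow> real) \<Rightarrow> (real ^ 'n \<Rightarrow> real) \<Rightarrow> (real ^ 'n \<Rightarrow> real) \<Rightarrow> real" where
  "Bt_form \<Omega> \<alpha> \<beta> \<gamma> g w u v =
     l2_inner \<Omega> (\<lambda>x. \<alpha> x (w x) *v grad \<Omega> u x + \<beta> x (w x)) (grad \<Omega> v) +
     l2_inner \<Omega> (\<lambda>x. \<gamma> x (w x) \<bullet> grad \<Omega> u x + g x (w x)) v"

definition B_form ::
  "(real ^ 'n) set \<Rightarrow> (real ^ 'n \<Rightarrow> real \<Rightarrow> real ^ 'n ^ 'n) \<Rightarrow> (real ^ 'n \<Rightarrow> real \<Rightarrow> real ^ 'n) \<Rightarrow>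
   (real ^ 'n \<Rightarrow> real \<Rightarrow> real ^ 'n) \<Rightarrow> (real ^ 'n \<Rightarrow> real \<Rightarrow> real) \<Rightarrow>
   (real ^ 'n \<Rightarrow> real) \<Rightarrow> (real ^ 'n \<Rightarrow> real) \<Rightarrow> real" where
  "B_form \<Omega> \<alpha> \<beta> \<gamma> g u v = Bt_form \<Omega> \<alpha> \<beta> \<gamma> g u u v"

section \<open>Discretization\<close>

definition fin_dim_subspace ::
  "(real ^ 'n \<Rightarrow> real) set \<Rightarrow> (real ^ 'n \<Rightarrow> real) set \<Rightarrow> bool" where
  "fin_dim_subspace S V \<longleftrightarrow> S \<subseteq> V \<and>
     (\<exists>E. finite E \<and> S = {(\<lambda>x. \<Sum>e\<in>E. c e * e x) | c. True})"

text \<open>The family \<open>S h\<close>, \<open>0 < h \<le> 1\<close>, with its approximation property and its inverse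
  inequality.\<close>

definition fe_family ::
  "(real ^ 'n) set \<Rightarrow> real \<Rightarrow> (real \<Rightarrow> (real ^ 'n \<Rightarrow> real) set) \<Rightarrow> bool" where
  "fe_family \<Omega> r S \<longleftrightarrow>
     (\<forall>h\<in>{0<..1}. fin_dim_subspace (S h) (H10 \<Omega>)) \<and>
     (\<exists>C. \<forall>h\<in>{0<..1}.
        (\<forall>v\<in>sobolev \<Omega> r \<inter> H10 \<Omega>.
           (INF \<psi>\<in>S h. l2_norm \<Omega> (\<lambda>x. v x - \<psi> x) + h * h1_norm \<Omega> (\<lambda>x. v x - \<psi> x))
             \<le> C * h powr r * sobolev_norm \<Omega> r v) \<and>
        (\<forall>\<psi>\<in>S h. AE x in lebesgue_on \<Omega>.
           norm (grad \<Omega> \<psi> x) \<le> C * h powr (- (real CARD('n) / 2)) * l2_norm \<Omega> (grad \<Omega> \<psi>)))"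

text \<open>\<open>\<omega> N n i\<close> are the weights for \<open>N\<close> time steps; the constant of the error term
  \<open>O(T / N)\<close> may depend on the integrand \<open>\<phi>\<close>, but not on \<open>N\<close> and \<open>n\<close>.\<close>

definition quadrature ::
  "real \<Rightarrow> (real \<Rightarrow> real) \<Rightarrow> (nat \<Rightarrow> nat \<Rightarrow> nat \<Rightarrow> real) \<Rightarrow> bool" where
  "quadrature T K \<omega> \<longleftrightarrow>
     (\<forall>\<phi>::real \<Rightarrow> real. smooth_on {0..T} \<phi> \<longrightarrow>
        (\<exists>M. \<forall>N\<ge>1. \<forall>n\<in>{1..N}. \<forall>dt. dt = T / real N \<longrightarrow>
           \<bar>dt * (\<Sum>i=1..n. \<omega> N n i * \<phi> (real i * dt)) -
             integral {0..real n * dt} (\<lambda>s. K (real n * dt - s) * \<phi> s)\<bar> \<le> M * dt))"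

text \<open>One grid of the two-grid scheme on the trial and test space \<open>V\<close>: \<open>W i\<close> is the function
  inserted into the nonlinear coefficients. The coarse step has \<open>W = U\<close>, the fine step takes
  for \<open>W\<close> the coarse solution. The fine problem at step \<open>n\<close> is coercive in the new unknown
  if \<open>\<mu>\<^sub>1 K\<^sub>1 dt < \<nu>\<^sub>0\<close>. The restriction \<open>dt \<le> 3 \<nu>\<^sub>0\<^sup>2 / (2 \<mu>\<^sub>1\<^sup>2 K\<^sub>1\<^sup>2 T)\<close> implies this
  for \<open>N \<ge> 2\<close>, where \<open>dt \<le> T / 2\<close>, but not for \<open>N = 1\<close>, where the fine problem can be
  singular.\<close>

definition scheme ::
  "(real ^ 'n) set \<Rightarrow>
   (real \<Rightarrow> (real ^ 'n \<Rightarrow> real) \<Rightarrow> (real ^ 'n \<Rightarrow> real) \<Rightarrow> real) \<Rightarrow>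
   ((real ^ 'n \<Rightarrow> real) \<Rightarrow> (real ^ 'n \<Rightarrow> real) \<Rightarrow> (real ^ 'n \<Rightarrow> real) \<Rightarrow> real) \<Rightarrow>
   (real \<Rightarrow> real ^ 'n \<Rightarrow> real) \<Rightarrow> (nat \<Rightarrow> nat \<Rightarrow> real) \<Rightarrow> nat \<Rightarrow> real \<Rightarrow>
   (real ^ 'n \<Rightarrow> real) set \<Rightarrow> (nat \<Rightarrow> real ^ 'n \<Rightarrow> real) \<Rightarrow> (nat \<Rightarrow> real ^ 'n \<Rightarrow> real) \<Rightarrow> bool" where
  "scheme \<Omega> A Bt f \<omega> N dt V W U \<longleftrightarrow>
     (\<forall>n\<le>N. U n \<in> V) \<and>
     (\<forall>n\<in>{1..N}. \<forall>v\<in>V.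
        1 / dt * l2_inner \<Omega> (\<lambda>x. U n x - U (n - 1) x) v + A (real n * dt) (U n) v
          + dt * (\<Sum>i=1..n. \<omega> n i * Bt (W i) (U i) v)
        = l2_inner \<Omega> (f (real n * dt)) v)"

definition two_grid_algorithm ::
  "(real ^ 'n) set \<Rightarrow>
   (real \<Rightarrow> (real ^ 'n \<Rightarrow> real) \<Rightarrow> (real ^ 'n \<Rightarrow> real) \<Rightarrow> real) \<Rightarrow>
   ((real ^ 'n \<Rightarrow> real) \<Rightarrow> (real ^ 'n \<Rightarrow> real) \<Rightarrow> (real ^ 'n \<Rightarrow> real) \<Rightarrow> real) \<Rightarrow>
   (real \<Rightarrow> real ^ 'n \<Rightarrow> real) \<Rightarrow> (nat \<Rightarrow> nat \<Rightarrow> real) \<Rightarrow> nat \<Rightarrow> real \<Rightarrow>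
   (real ^ 'n \<Rightarrow> real) set \<Rightarrow> (real ^ 'n \<Rightarrow> real) set \<Rightarrow>
   (nat \<Rightarrow> real ^ 'n \<Rightarrow> real) \<Rightarrow> (nat \<Rightarrow> real ^ 'n \<Rightarrow> real) \<Rightarrow> bool" where
  "two_grid_algorithm \<Omega> A Bt f \<omega> N dt S\<^sub>H S\<^sub>h U\<^sub>H U\<^sub>h \<longleftrightarrow>
     scheme \<Omega> A Bt f \<omega> N dt S\<^sub>H U\<^sub>H U\<^sub>H \<and> scheme \<Omega> A Bt f \<omega> N dt S\<^sub>h U\<^sub>H U\<^sub>h"

end

theory Submission
  imports Defs
begin

text \<open>
  Testing the scheme with \<open>v = U n\<close> turns the time difference into a telescoping difference of
  squares and makes the elliptic part coercive. The condition on \<open>dt\<close> lets the last memory term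
  \<open>i = n\<close> be absorbed by a fixed fraction of the coercivity constant; the remaining memory terms
  are lower order by Young's and the Cauchy--Schwarz inequality. As the \<open>L\<^sup>2\<close> norm is dominated by
  the \<open>H\<^sup>1\<close> norm, the source is absorbed as well, so an explicit discrete Gronwall inequality
  suffices. This is applied first to the coarse solution, with the bound on \<open>B_form\<close>, and then to
  the fine one, in which the coarse solution appears as data.
\<close>

section \<open>Discrete energy inequality\<close>

text \<open>Induction on the number of steps: each step grows by at most
  \<open>1 + c \<le> exp c\<close>, and a source entering late is charged the full exponential as
  well, which only enlarges it because sources are nonnegative. With only the old value
  \<open>E n\<close> on the right, no smallness of \<open>c\<close> is required.\<close>

lemma discrete_gronwall:
  fixes E g :: "nat \<Rightarrow> real"
  assumes "0 \<le> c" and "0 \<le> E 0" and g: "\<And>n. 0 \<le> g n"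
    and step: "\<And>n. n < M \<Longrightarrow> E (Suc n) \<le> (1 + c) * E n + g (Suc n)"
  shows "E M \<le> exp (c * real M) * (E 0 + (\<Sum>n=1..M. g n))"
proof -
  have "E n \<le> exp (c * real n) * (E 0 + (\<Sum>i=1..n. g i))" if "n \<le> M" for n
    using that
  proof (induction n)
    case 0
    then show ?case by simp
  next
    case (Suc n)
    let ?R = "E 0 + (\<Sum>i=1..n. g i)"
    have R: "0 \<le> ?R" using assms by (simp add: sum_nonneg)
    have "E (Suc n) \<le> (1 + c) * E n + g (Suc n)" using step Suc.prems by simp
    also have "\<dots> \<le> (1 + c) * (exp (c * real n) * ?R) + g (Suc n)"
      using Suc \<open>0 \<le> c\<close> by (intro add_right_mono mult_left_mono) auto
    also have "\<dots> \<le> exp c * (exp (c * real n) * ?R) + exp (c * real (Suc n)) * g (Suc n)"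
    proof (intro add_mono mult_right_mono)
      show "1 + c \<le> exp c" by simp
      show "0 \<le> exp (c * real n) * ?R" using R by simp
      have "1 * g (Suc n) \<le> exp (c * real (Suc n)) * g (Suc n)"
        using \<open>0 \<le> c\<close> g by (intro mult_right_mono) auto
      then show "g (Suc n) \<le> exp (c * real (Suc n)) * g (Suc n)" by simp
    qed
    also have "\<dots> = exp (c * real (Suc n)) * (E 0 + (\<Sum>i=1..Suc n. g i))"
      by (simp add: algebra_simps exp_add)
    finally show ?case .
  qed
  then show ?thesis by simp
qed

lemma young:
  fixes x y e :: real
  assumes "0 < e"
  shows "2 * x * y \<le> e * x\<^sup>2 + y\<^sup>2 / e"
proof -
  have "0 \<le> (e * x - y)\<^sup>2 / e" using assms by simp
  also have "\<dots> = e * x\<^sup>2 + y\<^sup>2 / e - 2 * x * y"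
    using assms by (simp add: field_simps power2_eq_square)
  finally show ?thesis by simp
qed

text \<open>The exponential is the Gronwall factor over the whole time interval. The summands
  \<open>1\<close>, \<open>3 / \<delta>\<close> and \<open>3 * T ^ 3 / \<delta>\<close> are the
  coefficients with which the initial value, the source and the bound \<open>G\<close> enter
  \<open>energy_estimate\<close>. Neither \<open>dt\<close> nor the number of steps occurs, which
  makes the final constant uniform.\<close>

definition stability_const :: "real \<Rightarrow> real \<Rightarrow> real \<Rightarrow> real" where
  "stability_const \<delta> T k =
     exp (3 * k\<^sup>2 * T\<^sup>2 / \<delta>\<^sup>2) * (1 + 3 / \<delta> + 3 * T ^ 3 / \<delta>)"

lemma stability_const_ge_1:
  assumes "0 < \<delta>" "0 < T"
  shows "1 \<le> stability_const \<delta> T k"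
proof -
  have "1 * 1 \<le> exp (3 * k\<^sup>2 * T\<^sup>2 / \<delta>\<^sup>2) * (1 + 3 / \<delta> + 3 * T ^ 3 / \<delta>)"
    using assms by (intro mult_mono) auto
  then show ?thesis unfolding stability_const_def by simp
qed

text \<open>The scheme reduced to real sequences: \<open>a\<close> stands for the L2 norms of the
  solution, \<open>d\<close> for those of its increments, \<open>x\<close> for the H1 norms,
  \<open>F\<close> for the source and \<open>b\<close> for given data in the memory term. Of the
  coercive \<open>2 * \<nu>\<close>, the newest memory term takes
  \<open>2 * (\<nu> - \<delta>)\<close>; the source, the older memory terms and the data take
  \<open>\<delta> / 3\<close> each, and one \<open>\<delta>\<close> survives on the left.\<close>

lemma energy_estimate:
  fixes a d x b F :: "nat \<Rightarrow> real"
  assumes \<delta>: "0 < \<delta>" and dt: "0 < dt" and T: "dt * real M \<le> T"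
    and small: "dt * k \<le> \<nu> - \<delta>" and "0 \<le> G"
    and bG: "\<And>i. i \<in> {1..M} \<Longrightarrow> (b i)\<^sup>2 \<le> G"
    and step: "\<And>n. n \<in> {1..M} \<Longrightarrow>
      (a n)\<^sup>2 - (a (n - 1))\<^sup>2 + (d n)\<^sup>2 + 2 * dt * \<nu> * (x n)\<^sup>2
        \<le> dt * (\<delta> / 3 * (x n)\<^sup>2 + 3 / \<delta> * (F n)\<^sup>2)
          + 2 * dt * x n * (dt * (\<Sum>i=1..n. k * x i + b i))"
  shows "(a M)\<^sup>2 + (\<Sum>i=1..M. (d i)\<^sup>2) + \<delta> * (dt * (\<Sum>i=1..M. (x i)\<^sup>2))
    \<le> stability_const \<delta> T k * ((a 0)\<^sup>2 + dt * (\<Sum>i=1..M. (F i)\<^sup>2) + G)"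
proof -
  have "0 \<le> T" using T dt by (meson mult_nonneg_nonneg of_nat_0_le_iff less_imp_le order_trans)
  \<comment> \<open>The memory reaches back to all earlier steps, so the energy must carry the
    accumulated squares of \<open>x\<close>: the past sum \<open>Y\<close> below is then at most
    \<open>E n / \<delta>\<close>. This costs one factor \<open>1 / \<delta>\<close> in
    \<open>c\<close>; the other comes from Young's inequality.\<close>
  define E where "E n = (a n)\<^sup>2 + (\<Sum>i=1..n. (d i)\<^sup>2) + \<delta> * (dt * (\<Sum>i=1..n. (x i)\<^sup>2))" for n
  define c where "c = 3 * k\<^sup>2 * T / \<delta>\<^sup>2"
  define g where "g n = dt * (3 / \<delta> * ((F n)\<^sup>2 + T\<^sup>2 * G))" for n
  \<comment> \<open>Cauchy-Schwarz for Riemann sums: the factor \<open>dt * card I\<close> is at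
    most \<open>T\<close>, so the number of steps disappears from the constants.\<close>
  have sumsq: "(dt * (\<Sum>i\<in>I. y i))\<^sup>2 \<le> T * (dt * (\<Sum>i\<in>I. (y i)\<^sup>2))"
    if "finite I" "card I \<le> M" for I :: "nat set" and y :: "nat \<Rightarrow> real"
  proof -
    have "dt * real (card I) \<le> T"
      using that(2) T dt by (meson mult_left_mono of_nat_le_iff less_imp_le order_trans)
    then have "(dt * real (card I)) * (dt * (\<Sum>i\<in>I. (y i)\<^sup>2)) \<le> T * (dt * (\<Sum>i\<in>I. (y i)\<^sup>2))"
      using dt by (intro mult_right_mono) (auto simp: sum_nonneg)
    moreover have "(dt * (\<Sum>i\<in>I. y i))\<^sup>2 \<le> dt\<^sup>2 * ((\<Sum>i\<in>I. (y i)\<^sup>2) * real (card I))"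
      unfolding power_mult_distrib
      by (intro mult_left_mono sum_squared_le_sum_of_squares that(1)) auto
    ultimately show ?thesis by (simp add: power2_eq_square algebra_simps)
  qed
  have rec: "E (Suc n) \<le> (1 + c * dt) * E n + g (Suc n)" if "n < M" for n
  proof -
    define X where "X = x (Suc n)"
    define P where "P = dt * (\<Sum>i=1..n. x i)"
    define Q where "Q = dt * (\<Sum>i=1..Suc n. b i)"
    define Y where "Y = dt * (\<Sum>i=1..n. (x i)\<^sup>2)"
    have P: "P\<^sup>2 \<le> T * Y" unfolding P_def Y_def using that by (intro sumsq) auto
    have Q: "Q\<^sup>2 \<le> T\<^sup>2 * G"
    proof -
      have "(\<Sum>i=1..Suc n. (b i)\<^sup>2) \<le> (\<Sum>i=1..Suc n. G)"
        using that by (intro sum_mono bG) auto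
      also have "\<dots> \<le> real M * G"
        using that \<open>0 \<le> G\<close> by (simp add: mult_right_mono del: of_nat_Suc)
      finally have "dt * (\<Sum>i=1..Suc n. (b i)\<^sup>2) \<le> dt * (real M * G)"
        using dt by (intro mult_left_mono) auto
      also have "\<dots> \<le> T * G" using mult_right_mono[OF T \<open>0 \<le> G\<close>] by simp
      finally have "T * (dt * (\<Sum>i=1..Suc n. (b i)\<^sup>2)) \<le> T * (T * G)"
        using \<open>0 \<le> T\<close> by (rule mult_left_mono)
      moreover have "Q\<^sup>2 \<le> T * (dt * (\<Sum>i=1..Suc n. (b i)\<^sup>2))"
        unfolding Q_def using that by (intro sumsq) auto
      ultimately show ?thesis by (simp add: power2_eq_square)
    qed
    \<comment> \<open>Only the newest term \<open>dt * k * X\<close> is quadratic in the current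
      unknown and needs the smallness of \<open>dt\<close>; the past \<open>P\<close> and the data
      \<open>Q\<close> are separated by Young's inequality.\<close>
    have mem: "dt * (\<Sum>i=1..Suc n. k * x i + b i) = k * P + dt * k * X + Q"
      unfolding P_def Q_def X_def
      by (simp add: sum.distrib sum_distrib_left algebra_simps)
    have y1: "2 * X * (k * P) \<le> \<delta> / 3 * X\<^sup>2 + 3 / \<delta> * (k\<^sup>2 * (T * Y))"
    proof -
      have "2 * X * (k * P) \<le> \<delta> / 3 * X\<^sup>2 + (k * P)\<^sup>2 / (\<delta> / 3)" using \<delta> by (intro young) auto
      also have "(k * P)\<^sup>2 / (\<delta> / 3) = 3 / \<delta> * (k\<^sup>2 * P\<^sup>2)" by (simp add: power_mult_distrib)
      also have "\<dots> \<le> 3 / \<delta> * (k\<^sup>2 * (T * Y))" using P \<delta> by (intro mult_left_mono) auto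
      finally show ?thesis by simp
    qed
    have y2: "2 * X * Q \<le> \<delta> / 3 * X\<^sup>2 + 3 / \<delta> * (T\<^sup>2 * G)"
    proof -
      have "2 * X * Q \<le> \<delta> / 3 * X\<^sup>2 + Q\<^sup>2 / (\<delta> / 3)" using \<delta> by (intro young) auto
      also have "Q\<^sup>2 / (\<delta> / 3) = 3 / \<delta> * Q\<^sup>2" by simp
      also have "\<dots> \<le> 3 / \<delta> * (T\<^sup>2 * G)" using Q \<delta> by (intro mult_left_mono) auto
      finally show ?thesis by simp
    qed
    have y3: "2 * X * (dt * k * X) \<le> 2 * (\<nu> - \<delta>) * X\<^sup>2"
      using mult_right_mono[OF small, of "2 * X\<^sup>2"] by (simp add: power2_eq_square algebra_simps)
    \<comment> \<open>The coefficient of \<open>X\<^sup>2\<close> is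
      \<open>2 * (\<nu> - \<delta>) + 2 * \<delta> / 3\<close>. The source term in
      \<open>step\<close> adds another \<open>\<delta> / 3\<close>, which leaves
      \<open>\<delta>\<close> for the left-hand side.\<close>
    have "2 * X * (k * P + dt * k * X + Q)
        \<le> 2 * \<nu> * X\<^sup>2 - 4 / 3 * (\<delta> * X\<^sup>2) + 3 / \<delta> * (k\<^sup>2 * (T * Y)) + 3 / \<delta> * (T\<^sup>2 * G)"
      using y1 y2 y3 by (simp add: algebra_simps)
    from mult_left_mono[OF this, of dt]
    have "2 * dt * X * (k * P + dt * k * X + Q)
        \<le> dt * (2 * \<nu> * X\<^sup>2 - 4 / 3 * (\<delta> * X\<^sup>2) + 3 / \<delta> * (k\<^sup>2 * (T * Y)) + 3 / \<delta> * (T\<^sup>2 * G))"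
      using dt by (simp add: mult.assoc mult.left_commute)
    with step[of "Suc n"] that
    have main: "(a (Suc n))\<^sup>2 + (d (Suc n))\<^sup>2 + \<delta> * (dt * X\<^sup>2)
        \<le> (a n)\<^sup>2 + dt * (3 / \<delta> * (k\<^sup>2 * (T * Y))) + g (Suc n)"
      unfolding mem g_def X_def[symmetric] by (simp add: algebra_simps)
    have "dt * (3 / \<delta> * (k\<^sup>2 * (T * Y))) = c * dt * (\<delta> * Y)"
      unfolding c_def using \<delta> by (simp add: power2_eq_square field_simps)
    also have "\<dots> \<le> c * dt * E n"
      unfolding E_def Y_def c_def using \<open>0 \<le> T\<close> dt \<delta>
      by (intro mult_left_mono) (auto simp: sum_nonneg)
    finally have "(a (Suc n))\<^sup>2 + (d (Suc n))\<^sup>2 + \<delta> * (dt * X\<^sup>2)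
        \<le> (a n)\<^sup>2 + c * dt * E n + g (Suc n)" using main by linarith
    then show ?thesis unfolding E_def X_def by (simp add: algebra_simps)
  qed
  have "E M \<le> exp (c * dt * real M) * (E 0 + (\<Sum>n=1..M. g n))"
  proof (rule discrete_gronwall)
    show "0 \<le> c * dt" unfolding c_def using \<open>0 \<le> T\<close> dt by simp
    show "0 \<le> E 0" unfolding E_def by simp
    show "0 \<le> g n" for n unfolding g_def using dt \<delta> \<open>0 \<le> G\<close> by simp
  qed (use rec in blast)
  also have "\<dots> \<le> exp (3 * k\<^sup>2 * T\<^sup>2 / \<delta>\<^sup>2) *
      ((1 + 3 / \<delta> + 3 * T ^ 3 / \<delta>) * ((a 0)\<^sup>2 + dt * (\<Sum>i=1..M. (F i)\<^sup>2) + G))"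
  proof (intro mult_mono)
    have "c * (dt * real M) \<le> c * T"
      unfolding c_def using \<open>0 \<le> T\<close> T by (intro mult_left_mono) auto
    then show "exp (c * dt * real M) \<le> exp (3 * k\<^sup>2 * T\<^sup>2 / \<delta>\<^sup>2)"
      unfolding c_def by (simp add: power2_eq_square mult.assoc)
    let ?S = "dt * (\<Sum>i=1..M. (F i)\<^sup>2)" and ?L = "3 * T ^ 3 / \<delta>"
    have S: "0 \<le> ?S" using dt by (simp add: sum_nonneg)
    have L: "0 \<le> ?L" using \<delta> \<open>0 \<le> T\<close> by simp
    have "(\<Sum>n=1..M. g n) = 3 / \<delta> * ?S + (dt * real M) * (3 / \<delta> * (T\<^sup>2 * G))"
      unfolding g_def by (simp add: sum.distrib sum_distrib_left algebra_simps)
    also have "\<dots> \<le> 3 / \<delta> * ?S + T * (3 / \<delta> * (T\<^sup>2 * G))"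
      using T \<delta> \<open>0 \<le> G\<close> by (intro add_left_mono mult_right_mono) auto
    also have "\<dots> = 3 / \<delta> * ?S + ?L * G" by (simp add: power2_eq_square power3_eq_cube)
    finally have gs: "(\<Sum>n=1..M. g n) \<le> 3 / \<delta> * ?S + ?L * G" .
    \<comment> \<open>These are exactly the terms of the expanded product on the right that exceed
      \<open>(a 0)\<^sup>2 + 3 / \<delta> * ?S + ?L * G\<close>.\<close>
    have "0 \<le> ?S + G + 3 / \<delta> * ((a 0)\<^sup>2 + G) + ?L * ((a 0)\<^sup>2 + ?S)"
      using S L \<delta> \<open>0 \<le> G\<close> by (intro add_nonneg_nonneg mult_nonneg_nonneg[of _ "_ + _"]) auto
    with gs show "E 0 + (\<Sum>n=1..M. g n) \<le> (1 + 3 / \<delta> + ?L) * ((a 0)\<^sup>2 + ?S + G)"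
      unfolding E_def by (simp add: ring_distribs)
    show "0 \<le> E 0 + (\<Sum>n=1..M. g n)"
      unfolding E_def g_def using dt \<delta> \<open>0 \<le> G\<close> by (auto intro!: add_nonneg_nonneg sum_nonneg)
  qed auto
  finally show ?thesis unfolding E_def stability_const_def by (simp add: mult.assoc)
qed

section \<open>The norms\<close>

lemma l2_norm_power2:
  fixes u :: "real ^ 'n \<Rightarrow> real"
  shows "(l2_norm \<Omega> u)\<^sup>2 = l2_inner \<Omega> u u"
  unfolding l2_norm_def l2_inner_def by (simp add: integral_nonneg)

lemma l2_norm_nonneg:
  fixes u :: "real ^ 'n \<Rightarrow> real"
  shows "0 \<le> l2_norm \<Omega> u"
  unfolding l2_norm_def l2_inner_def by (simp add: integral_nonneg)

lemma integrable_mult_L2: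
  assumes "u \<in> L2 \<Omega>" "v \<in> L2 \<Omega>"
  shows "integrable (lebesgue_on \<Omega>) (\<lambda>x. u x * v x)"
proof (rule Bochner_Integration.integrable_bound)
  show "integrable (lebesgue_on \<Omega>) (\<lambda>x. (u x)\<^sup>2 + (v x)\<^sup>2)"
    using assms unfolding L2_def by auto
  show "(\<lambda>x. u x * v x) \<in> borel_measurable (lebesgue_on \<Omega>)"
    using assms unfolding L2_def by auto
  have "\<bar>s * t\<bar> \<le> s\<^sup>2 + t\<^sup>2" for s t :: real
    using young[of 1 s t] young[of 1 s "- t"] by (auto simp: abs_le_iff)
  then show "AE x in lebesgue_on \<Omega>. norm (u x * v x) \<le> norm ((u x)\<^sup>2 + (v x)\<^sup>2)"
    by (auto intro!: AE_I2)
qed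

text \<open>The pointwise identity
  \<open>2 * (p - q) * p = p\<^sup>2 - q\<^sup>2 + (p - q)\<^sup>2\<close>, integrated; its last
  term supplies the control of the increments. Membership in \<open>L2\<close> makes all products
  integrable, so that the integrals may be split.\<close>

lemma l2_inner_diff_polarization:
  assumes "u \<in> L2 \<Omega>" "v \<in> L2 \<Omega>"
  shows "2 * l2_inner \<Omega> (\<lambda>x. u x - v x) u =
    (l2_norm \<Omega> u)\<^sup>2 - (l2_norm \<Omega> v)\<^sup>2 + (l2_norm \<Omega> (\<lambda>x. u x - v x))\<^sup>2"
proof -
  note [simp] = integrable_mult_L2[OF assms(1,1)] integrable_mult_L2[OF assms]
    integrable_mult_L2[OF assms(2,2)] integrable_mult_L2[OF assms(2,1)]
  have [simp]: "(LINT x|lebesgue_on \<Omega>. v x * u x) = (LINT x|lebesgue_on \<Omega>. u x * v x)"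
    by (intro Bochner_Integration.integral_cong) auto
  have "(LINT x|lebesgue_on \<Omega>. (u x - v x) * u x) =
      (LINT x|lebesgue_on \<Omega>. u x * u x) - (LINT x|lebesgue_on \<Omega>. v x * u x)"
    by (simp add: left_diff_distrib)
  moreover have "(LINT x|lebesgue_on \<Omega>. (u x - v x) * (u x - v x)) =
      (LINT x|lebesgue_on \<Omega>. u x * u x) - (LINT x|lebesgue_on \<Omega>. v x * u x)
      - ((LINT x|lebesgue_on \<Omega>. u x * v x) - (LINT x|lebesgue_on \<Omega>. v x * v x))"
    by (simp add: left_diff_distrib right_diff_distrib)
  ultimately show ?thesis
    unfolding l2_norm_power2 l2_inner_def by simp
qed

lemma l2_inner_young:
  assumes "u \<in> L2 \<Omega>" "v \<in> L2 \<Omega>" "0 < e"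
  shows "2 * l2_inner \<Omega> u v \<le> e * (l2_norm \<Omega> v)\<^sup>2 + (l2_norm \<Omega> u)\<^sup>2 / e"
proof -
  note [simp] = integrable_mult_L2[OF assms(1,1)] integrable_mult_L2[OF assms(1,2)]
    integrable_mult_L2[OF assms(2,2)]
  have "2 * l2_inner \<Omega> u v = (LINT x|lebesgue_on \<Omega>. 2 * (u x * v x))"
    unfolding l2_inner_def by simp
  also have "\<dots> \<le> (LINT x|lebesgue_on \<Omega>. e * (v x * v x) + (u x * u x) / e)"
  proof (rule integral_mono)
    show "2 * (u x * v x) \<le> e * (v x * v x) + u x * u x / e" for x
      using young[OF \<open>0 < e\<close>, of "v x" "u x"] by (simp add: power2_eq_square mult_ac)
  qed auto
  also have "\<dots> = e * (l2_norm \<Omega> v)\<^sup>2 + (l2_norm \<Omega> u)\<^sup>2 / e"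
    unfolding l2_norm_power2 l2_inner_def by simp
  finally show ?thesis .
qed

text \<open>\<open>Dw\<close> returns the function itself for the zero multi-index, so the squared
  L2 norm is one summand of the squared H1 norm. The index set has to be shown finite because a sum
  over an infinite set is 0 by default.\<close>

lemma l2_norm_le_h1_norm:
  fixes u :: "real ^ 'n \<Rightarrow> real"
  shows "l2_norm \<Omega> u \<le> h1_norm \<Omega> u"
proof -
  let ?M = "{m :: 'n \<Rightarrow> nat. mi_order m \<le> 1}"
  have "m j \<le> mi_order m" for m :: "'n \<Rightarrow> nat" and j by (rule member_le_sum) auto
  then have "?M \<subseteq> PiE UNIV (\<lambda>_. {..1})" by (auto intro: order_trans)
  then have "finite ?M" by (rule finite_subset) (intro finite_PiE, auto)
  then have "(l2_norm \<Omega> (Dw \<Omega> (\<lambda>_. 0) u))\<^sup>2 \<le> (\<Sum>m\<in>?M. (l2_norm \<Omega> (Dw \<Omega> m u))\<^sup>2)"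
    by (intro member_le_sum) auto
  then show ?thesis
    unfolding sobolev_norm_def by (intro real_le_rsqrt) (simp add: Dw_def)
qed

lemma H10_imp_L2: "u \<in> H10 \<Omega> \<Longrightarrow> u \<in> L2 \<Omega>"
  unfolding H10_def sobolev_def by blast

section \<open>Stability of the two-grid scheme\<close>

text \<open>Serves both grids. The coarse one has \<open>W = U\<close>, \<open>\<mu>' = 0\<close>
  and \<open>G = 0\<close>; the fine one has the coarse solution as \<open>W\<close> and its
  stability bound in \<open>G\<close>. Stopping at any \<open>M \<le> N\<close> lets the data on the
  right be summed only up to the step considered.\<close>

lemma scheme_stability:
  fixes U W :: "nat \<Rightarrow> real ^ 'n \<Rightarrow> real"
  assumes scheme: "scheme \<Omega> A Bt f \<omega> N dt V W U" and V: "V \<subseteq> H10 \<Omega>"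
    and \<delta>: "0 < \<delta>" and dt: "0 < dt" "dt * real N = T"
    and f: "\<And>t. t \<in> {0..T} \<Longrightarrow> f t \<in> L2 \<Omega>"
    and coercive: "\<And>t v. t \<in> {0..T} \<Longrightarrow> v \<in> H10 \<Omega> \<Longrightarrow> \<nu> * (h1_norm \<Omega> v)\<^sup>2 \<le> A t v v"
    and Bt: "\<And>i v. i \<in> {1..N} \<Longrightarrow> v \<in> V \<Longrightarrow>
      \<bar>Bt (W i) (U i) v\<bar> \<le> \<mu> * h1_norm \<Omega> (U i) * h1_norm \<Omega> v + \<mu>' * l2_norm \<Omega> (W i) * h1_norm \<Omega> v"
    and \<omega>: "\<And>n i. 1 \<le> i \<Longrightarrow> i \<le> n \<Longrightarrow> n \<le> N \<Longrightarrow> \<bar>\<omega> n i\<bar> \<le> K\<^sub>1"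
    and "0 \<le> K\<^sub>1" and small: "dt * (K\<^sub>1 * \<mu>) \<le> \<nu> - \<delta>"
    and M: "M \<le> N" and "0 \<le> G" and WG: "\<And>i. i \<in> {1..M} \<Longrightarrow> (K\<^sub>1 * \<mu>' * l2_norm \<Omega> (W i))\<^sup>2 \<le> G"
  shows "(l2_norm \<Omega> (U M))\<^sup>2 + (\<Sum>i=1..M. (l2_norm \<Omega> (\<lambda>x. U i x - U (i - 1) x))\<^sup>2)
      + \<delta> * (dt * (\<Sum>i=1..M. (h1_norm \<Omega> (U i))\<^sup>2))
    \<le> stability_const \<delta> T (K\<^sub>1 * \<mu>) *
      ((l2_norm \<Omega> (U 0))\<^sup>2 + dt * (\<Sum>i=1..M. (l2_norm \<Omega> (f (real i * dt)))\<^sup>2) + G)"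
proof (rule energy_estimate[where b = "\<lambda>i. K\<^sub>1 * \<mu>' * l2_norm \<Omega> (W i)" and \<nu> = \<nu>])
  show "dt * real M \<le> T" using M dt by (metis mult_left_mono of_nat_le_iff less_imp_le)
  fix n assume "n \<in> {1..M}"
  with M have n: "n \<in> {1..N}" by auto
  then have t: "real n * dt \<in> {0..T}"
    using dt by (auto simp: mult.commute[of dt] intro!: mult_right_mono)
  have UV: "U i \<in> V" if "i \<le> N" for i using scheme that unfolding scheme_def by blast
  then have H: "U i \<in> H10 \<Omega>" if "i \<le> N" for i using that V by blast
  have L: "U n \<in> L2 \<Omega>" "U (n - 1) \<in> L2 \<Omega>" using n by (auto intro!: H10_imp_L2 H)
  let ?x = "\<lambda>i. h1_norm \<Omega> (U i)" and ?b = "\<lambda>i. l2_norm \<Omega> (W i)"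
  let ?D = "\<lambda>x. U n x - U (n - 1) x" and ?F = "l2_norm \<Omega> (f (real n * dt))"
  let ?S = "\<Sum>i=1..n. \<omega> n i * Bt (W i) (U i) (U n)"
  have eq: "1 / dt * l2_inner \<Omega> ?D (U n) + A (real n * dt) (U n) (U n) + dt * ?S
      = l2_inner \<Omega> (f (real n * dt)) (U n)"
    using scheme n UV[of n] unfolding scheme_def by auto
  \<comment> \<open>The weights may have either sign, so the memory sum is moved to the right and
    estimated in absolute value; the norm of the test function \<open>U n\<close> factors
    out.\<close>
  have mem: "- ?S \<le> ?x n * (\<Sum>i=1..n. K\<^sub>1 * \<mu> * ?x i + K\<^sub>1 * \<mu>' * ?b i)"
  proof -
    have "- ?S \<le> (\<Sum>i=1..n. \<bar>\<omega> n i * Bt (W i) (U i) (U n)\<bar>)"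
      using sum_abs[of "\<lambda>i. \<omega> n i * Bt (W i) (U i) (U n)" "{1..n}"] by linarith
    also have "\<dots> \<le> (\<Sum>i=1..n. K\<^sub>1 * (\<mu> * ?x i * ?x n + \<mu>' * ?b i * ?x n))"
      unfolding abs_mult using n UV[of n] \<open>0 \<le> K\<^sub>1\<close>
      by (intro sum_mono mult_mono \<omega> Bt) auto
    also have "\<dots> = ?x n * (\<Sum>i=1..n. K\<^sub>1 * \<mu> * ?x i + K\<^sub>1 * \<mu>' * ?b i)"
      unfolding sum_distrib_left by (simp add: algebra_simps)
    finally show ?thesis .
  qed
  have src: "2 * l2_inner \<Omega> (f (real n * dt)) (U n) \<le> \<delta> / 3 * (?x n)\<^sup>2 + 3 / \<delta> * ?F\<^sup>2"
  proof -
    have "2 * l2_inner \<Omega> (f (real n * dt)) (U n)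
        \<le> \<delta> / 3 * (l2_norm \<Omega> (U n))\<^sup>2 + ?F\<^sup>2 / (\<delta> / 3)"
      using f[OF t] L \<delta> by (intro l2_inner_young) auto
    also have "\<delta> / 3 * (l2_norm \<Omega> (U n))\<^sup>2 \<le> \<delta> / 3 * (?x n)\<^sup>2"
      using \<delta> l2_norm_le_h1_norm l2_norm_nonneg by (intro mult_left_mono power_mono) auto
    finally show ?thesis by simp
  qed
  have co: "\<nu> * (?x n)\<^sup>2 \<le> A (real n * dt) (U n) (U n)" using coercive t H[of n] n by auto
  let ?R = "\<Sum>i=1..n. K\<^sub>1 * \<mu> * ?x i + K\<^sub>1 * \<mu>' * ?b i"
  \<comment> \<open>The tested equation is solved for the difference quotient and multiplied by
    \<open>2 * dt\<close>, to match the polarization identity.\<close>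
  have "2 * l2_inner \<Omega> ?D (U n) = 2 * dt * (1 / dt * l2_inner \<Omega> ?D (U n))" using dt by simp
  also have "1 / dt * l2_inner \<Omega> ?D (U n)
      = l2_inner \<Omega> (f (real n * dt)) (U n) - A (real n * dt) (U n) (U n) - dt * ?S"
    using eq by linarith
  also have "2 * dt * \<dots> = dt * (2 * l2_inner \<Omega> (f (real n * dt)) (U n)) - 2 * dt * A (real n * dt) (U n) (U n)
      + 2 * dt * (dt * (- ?S))"
    by (simp add: algebra_simps)
  also have "\<dots> \<le> dt * (\<delta> / 3 * (?x n)\<^sup>2 + 3 / \<delta> * ?F\<^sup>2) - 2 * dt * (\<nu> * (?x n)\<^sup>2)
      + 2 * dt * (dt * (?x n * ?R))"
    using dt by (intro add_mono diff_mono mult_left_mono src co mem) auto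
  finally show "(l2_norm \<Omega> (U n))\<^sup>2 - (l2_norm \<Omega> (U (n - 1)))\<^sup>2 + (l2_norm \<Omega> ?D)\<^sup>2
      + 2 * dt * \<nu> * (?x n)\<^sup>2 \<le> dt * (\<delta> / 3 * (?x n)\<^sup>2 + 3 / \<delta> * ?F\<^sup>2) + 2 * dt * ?x n * (dt * ?R)"
    unfolding l2_inner_diff_polarization[OF L] by (simp add: mult.assoc mult.left_commute)
qed (use assms in auto)

lemma fe_familyD: "fe_family \<Omega> r S \<Longrightarrow> h \<in> {0<..1} \<Longrightarrow> S h \<subseteq> H10 \<Omega>"
  unfolding fe_family_def fin_dim_subspace_def by blast

text \<open>The coarse step uses \<open>q = 7/8\<close> and \<open>dt \<le> T\<close>, the fine one \<open>q = 3/2\<close> and, for \<open>N \<ge> 2\<close>,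
  \<open>dt \<le> T / 2\<close>: both \<open>7/8\<close> and \<open>3/4\<close> are below \<open>(19/20)\<^sup>2\<close>.\<close>

lemma step_size_absorption:
  fixes \<mu> K\<^sub>1 T dt \<nu> q :: real
  assumes "dt \<le> q * \<nu>\<^sup>2 / (\<mu>\<^sup>2 * K\<^sub>1\<^sup>2 * T)" and "0 < \<mu>" "0 < K\<^sub>1" "0 < T" "0 < dt" "0 < \<nu>"
    and "q * dt \<le> (19 / 20)\<^sup>2 * T"
  shows "dt * (K\<^sub>1 * \<mu>) \<le> \<nu> - \<nu> / 20"
proof -
  have "dt * (\<mu>\<^sup>2 * K\<^sub>1\<^sup>2 * T) \<le> q * \<nu>\<^sup>2"
    using assms(1) assms(2-4) by (simp add: pos_le_divide_eq)
  from mult_left_mono[OF this, of dt]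
  have "(dt * (K\<^sub>1 * \<mu>))\<^sup>2 * T \<le> (q * dt) * \<nu>\<^sup>2"
    using \<open>0 < dt\<close> by (simp add: power2_eq_square algebra_simps)
  also have "\<dots> \<le> ((19 / 20)\<^sup>2 * T) * \<nu>\<^sup>2" using assms(7) by (rule mult_right_mono) simp
  also have "\<dots> = (19 / 20 * \<nu>)\<^sup>2 * T" by (simp add: power2_eq_square)
  finally have "(dt * (K\<^sub>1 * \<mu>))\<^sup>2 \<le> (19 / 20 * \<nu>)\<^sup>2" using \<open>0 < T\<close> by simp
  then have "dt * (K\<^sub>1 * \<mu>) \<le> 19 / 20 * \<nu>" by (rule power2_le_imp_le) (use \<open>0 < \<nu>\<close> in simp)
  then show ?thesis by simp
qed

theorem theorem4p1:
  fixes \<Omega> :: "(real ^ 'n) set"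
    and T r \<nu>\<^sub>0 \<nu>\<^sub>1 \<mu>\<^sub>0 \<mu>\<^sub>1 \<mu>\<^sub>2 K\<^sub>1 :: real
    and a :: "real ^ 'n \<Rightarrow> real \<Rightarrow> real ^ 'n ^ 'n"
    and a\<^sub>0 :: "real ^ 'n \<Rightarrow> real \<Rightarrow> real"
    and \<alpha> :: "real ^ 'n \<Rightarrow> real \<Rightarrow> real ^ 'n ^ 'n"
    and \<beta> \<gamma> :: "real ^ 'n \<Rightarrow> real \<Rightarrow> real ^ 'n"
    and g :: "real ^ 'n \<Rightarrow> real \<Rightarrow> real"
    and S :: "real \<Rightarrow> (real ^ 'n \<Rightarrow> real) set"
    and K :: "real \<Rightarrow> real"
    and \<omega> :: "nat \<Rightarrow> nat \<Rightarrow> nat \<Rightarrow> real"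
  assumes "polyhedral_domain \<Omega>" and "T > 0"
    and "symmetric_elliptic \<Omega> T a a\<^sub>0"
    and "\<nu>\<^sub>0 > 0" and "\<nu>\<^sub>1 > 0"
    and "\<And>t v. t \<in> {0..T} \<Longrightarrow> v \<in> H10 \<Omega> \<Longrightarrow> A_form \<Omega> a a\<^sub>0 t v v \<ge> \<nu>\<^sub>0 * (h1_norm \<Omega> v)\<^sup>2"
    and "\<And>t u v. t \<in> {0..T} \<Longrightarrow> u \<in> H10 \<Omega> \<Longrightarrow> v \<in> H10 \<Omega> \<Longrightarrow>
           \<bar>A_form \<Omega> a a\<^sub>0 t u v\<bar> \<le> \<nu>\<^sub>1 * h1_norm \<Omega> u * h1_norm \<Omega> v"
    and "B_coefficients \<Omega> \<alpha> \<beta> \<gamma> g"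
    and "\<mu>\<^sub>0 > 0" and "\<mu>\<^sub>1 > 0" and "\<mu>\<^sub>2 > 0"
    and "\<And>u v. u \<in> H10 \<Omega> \<Longrightarrow> v \<in> H10 \<Omega> \<Longrightarrow>
           \<bar>B_form \<Omega> \<alpha> \<beta> \<gamma> g u v\<bar> \<le> \<mu>\<^sub>0 * h1_norm \<Omega> u * h1_norm \<Omega> v"
    and "\<And>w u v. w \<in> H10 \<Omega> \<Longrightarrow> u \<in> H10 \<Omega> \<Longrightarrow> v \<in> H10 \<Omega> \<Longrightarrow>
           \<bar>Bt_form \<Omega> \<alpha> \<beta> \<gamma> g w u v\<bar>
             \<le> \<mu>\<^sub>1 * h1_norm \<Omega> u * h1_norm \<Omega> v + \<mu>\<^sub>2 * l2_norm \<Omega> w * h1_norm \<Omega> v"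
    and "r \<ge> 1 + real CARD('n) / 2" and "fe_family \<Omega> r S"
    and "K absolutely_integrable_on {0..T}" and "quadrature T K \<omega>"
    and "\<And>N n i. 1 \<le> i \<Longrightarrow> i \<le> n \<Longrightarrow> n \<le> N \<Longrightarrow> \<bar>\<omega> N n i\<bar> \<le> K\<^sub>1"
    and "\<And>N n. 1 \<le> n \<Longrightarrow> n \<le> N \<Longrightarrow> \<omega> N n n \<noteq> 0"
  shows "\<exists>C>0. \<forall>h H N dt f U\<^sub>H U\<^sub>h.
    0 < h \<longrightarrow> h < H \<longrightarrow> H \<le> 1 \<longrightarrow> N \<ge> 1 \<longrightarrow> dt = T / real N \<longrightarrow>
    (\<forall>t\<in>{0..T}. f t \<in> L2 \<Omega>) \<longrightarrow>
    two_grid_algorithm \<Omega> (A_form \<Omega> a a\<^sub>0) (Bt_form \<Omega> \<alpha> \<beta> \<gamma> g) f (\<omega> N) N dt (S H) (S h) U\<^sub>H U\<^sub>h \<longrightarrow>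
    dt \<le> min (1/2) (7 * \<nu>\<^sub>0\<^sup>2 / (8 * \<mu>\<^sub>0\<^sup>2 * K\<^sub>1\<^sup>2 * T)) \<longrightarrow>
    dt \<le> min (1/2) (3 * \<nu>\<^sub>0\<^sup>2 / (2 * \<mu>\<^sub>1\<^sup>2 * K\<^sub>1\<^sup>2 * T)) \<longrightarrow>
    (N = 1 \<longrightarrow> \<mu>\<^sub>1 * K\<^sub>1 * dt < \<nu>\<^sub>0) \<longrightarrow>
    (\<forall>n\<in>{1..N}.
      (SUP i\<in>{1..n}. l2_norm \<Omega> (U\<^sub>h i))
      + sqrt (\<Sum>i=1..n. (l2_norm \<Omega> (\<lambda>x. U\<^sub>h i x - U\<^sub>h (i - 1) x))\<^sup>2)
      + sqrt \<nu>\<^sub>0 / 2 * sqrt (\<Sum>i=1..n. dt * (h1_norm \<Omega> (U\<^sub>h i))\<^sup>2)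
      \<le> C * sqrt ((l2_norm \<Omega> (U\<^sub>h 0))\<^sup>2 + (l2_norm \<Omega> (U\<^sub>H 0))\<^sup>2
                  + dt * (\<Sum>i=1..n. (l2_norm \<Omega> (f (real i * dt)))\<^sup>2)))"
proof -
  \<comment> \<open>The coercivity left over on the fine grid. The first branch covers \<open>N = 1\<close>, where \<open>dt = T\<close>
    and the step size condition alone would allow the memory term to exceed the elliptic one.\<close>
  define \<delta>\<^sub>1 where "\<delta>\<^sub>1 = (if \<mu>\<^sub>1 * K\<^sub>1 * T < \<nu>\<^sub>0 then min (\<nu>\<^sub>0 / 20) (\<nu>\<^sub>0 - \<mu>\<^sub>1 * K\<^sub>1 * T) else \<nu>\<^sub>0 / 20)"
  define C\<^sub>0 where "C\<^sub>0 = stability_const (\<nu>\<^sub>0 / 20) T (K\<^sub>1 * \<mu>\<^sub>0)"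
  \<comment> \<open>The \<open>1\<close> accounts for the data of the fine problem itself, the other
    summand for the coarse solution, whose squared norms are at most \<open>C\<^sub>0\<close> times
    the data.\<close>
  define Q where "Q = stability_const \<delta>\<^sub>1 T (K\<^sub>1 * \<mu>\<^sub>1) * (1 + (K\<^sub>1 * \<mu>\<^sub>2)\<^sup>2 * C\<^sub>0)"
  \<comment> \<open>The supremum and the increments each cost \<open>sqrt Q\<close>. The H1 sum
    costs an extra \<open>sqrt (1 / \<delta>\<^sub>1)\<close>, since the energy carries it only with
    weight \<open>\<delta>\<^sub>1\<close>.\<close>
  define C where "C = (2 + sqrt \<nu>\<^sub>0 / 2 * sqrt (1 / \<delta>\<^sub>1)) * sqrt Q"
  have \<delta>\<^sub>1: "0 < \<delta>\<^sub>1" unfolding \<delta>\<^sub>1_def using \<open>\<nu>\<^sub>0 > 0\<close> by auto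
  have C\<^sub>0: "1 \<le> C\<^sub>0" unfolding C\<^sub>0_def using \<open>\<nu>\<^sub>0 > 0\<close> \<open>T > 0\<close> by (intro stability_const_ge_1) auto
  have st1: "1 \<le> stability_const \<delta>\<^sub>1 T (K\<^sub>1 * \<mu>\<^sub>1)"
    using \<delta>\<^sub>1 \<open>T > 0\<close> by (rule stability_const_ge_1)
  then have Q: "0 < Q" unfolding Q_def using C\<^sub>0 by (intro mult_pos_pos add_pos_nonneg) auto
  have C: "0 < C" unfolding C_def using Q \<open>\<nu>\<^sub>0 > 0\<close> \<delta>\<^sub>1
    by (intro mult_pos_pos add_pos_nonneg) auto
  \<comment> \<open>A nonzero weight bounded by \<open>K\<^sub>1\<close> in absolute value forces
    positivity.\<close>
  have K\<^sub>1: "0 < K\<^sub>1" using assms(18)[of 1 1 1] assms(19)[of 1 1] by auto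
  have bound: "(SUP i\<in>{1..n}. l2_norm \<Omega> (U\<^sub>h i))
      + sqrt (\<Sum>i=1..n. (l2_norm \<Omega> (\<lambda>x. U\<^sub>h i x - U\<^sub>h (i - 1) x))\<^sup>2)
      + sqrt \<nu>\<^sub>0 / 2 * sqrt (\<Sum>i=1..n. dt * (h1_norm \<Omega> (U\<^sub>h i))\<^sup>2)
      \<le> C * sqrt ((l2_norm \<Omega> (U\<^sub>h 0))\<^sup>2 + (l2_norm \<Omega> (U\<^sub>H 0))\<^sup>2
                  + dt * (\<Sum>i=1..n. (l2_norm \<Omega> (f (real i * dt)))\<^sup>2))"
    if hH: "0 < h" "h < H" "H \<le> 1" and N: "N \<ge> 1" "dt = T / real N"
      and f: "\<forall>t\<in>{0..T}. f t \<in> L2 \<Omega>"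
      and alg: "two_grid_algorithm \<Omega> (A_form \<Omega> a a\<^sub>0) (Bt_form \<Omega> \<alpha> \<beta> \<gamma> g) f (\<omega> N) N dt
        (S H) (S h) U\<^sub>H U\<^sub>h"
      and dt0: "dt \<le> min (1/2) (7 * \<nu>\<^sub>0\<^sup>2 / (8 * \<mu>\<^sub>0\<^sup>2 * K\<^sub>1\<^sup>2 * T))"
      and dt1: "dt \<le> min (1/2) (3 * \<nu>\<^sub>0\<^sup>2 / (2 * \<mu>\<^sub>1\<^sup>2 * K\<^sub>1\<^sup>2 * T))"
      and N1: "N = 1 \<longrightarrow> \<mu>\<^sub>1 * K\<^sub>1 * dt < \<nu>\<^sub>0"
      and n: "n \<in> {1..N}"
    for h H N dt f U\<^sub>H U\<^sub>h n
  proof -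
    have dt: "0 < dt" "dt * real N = T" using N \<open>T > 0\<close> by auto
    have VH: "S H \<subseteq> H10 \<Omega>" and Vh: "S h \<subseteq> H10 \<Omega>"
      using hH fe_familyD[OF assms(15)] by auto
    have sH: "scheme \<Omega> (A_form \<Omega> a a\<^sub>0) (Bt_form \<Omega> \<alpha> \<beta> \<gamma> g) f (\<omega> N) N dt (S H) U\<^sub>H U\<^sub>H"
      and sh: "scheme \<Omega> (A_form \<Omega> a a\<^sub>0) (Bt_form \<Omega> \<alpha> \<beta> \<gamma> g) f (\<omega> N) N dt (S h) U\<^sub>H U\<^sub>h"
      using alg unfolding two_grid_algorithm_def by auto
    have UH: "U\<^sub>H i \<in> H10 \<Omega>" and Uh: "U\<^sub>h i \<in> H10 \<Omega>" if "i \<le> N" for i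
      using sH sh VH Vh that unfolding scheme_def by auto
    have "dt \<le> T" using mult_left_mono[of 1 "real N" dt] N(1) dt by simp

    \<comment> \<open>Absorption of the newest memory term on both grids\<close>
    have small0: "dt * (K\<^sub>1 * \<mu>\<^sub>0) \<le> \<nu>\<^sub>0 - \<nu>\<^sub>0 / 20"
      using dt0 \<open>\<mu>\<^sub>0 > 0\<close> \<open>T > 0\<close> \<open>\<nu>\<^sub>0 > 0\<close> K\<^sub>1 dt \<open>dt \<le> T\<close>
      by (intro step_size_absorption[where q = "7 / 8" and T = T])
        (auto simp: power2_eq_square mult.assoc)
    have small1: "dt * (K\<^sub>1 * \<mu>\<^sub>1) \<le> \<nu>\<^sub>0 - \<delta>\<^sub>1"
    \<comment> \<open>The branch of \<open>\<delta>\<^sub>1\<close> is decided by \<open>T\<close>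
      and not by \<open>N\<close>, so the constant is uniform in \<open>N\<close>. For
      \<open>N = 1\<close> the extra hypothesis selects the first branch; for larger
      \<open>N\<close> either branch is at most \<open>\<nu>\<^sub>0 / 20\<close>.\<close>
    proof (cases "N = 1")
      case True
      then have "dt = T" using N by simp
      with N1 True show ?thesis unfolding \<delta>\<^sub>1_def by (auto simp: algebra_simps)
    next
      case False
      then have "dt * 2 \<le> dt * real N" using N dt by (intro mult_left_mono) auto
      then have "dt * (K\<^sub>1 * \<mu>\<^sub>1) \<le> \<nu>\<^sub>0 - \<nu>\<^sub>0 / 20"
        using dt1 \<open>\<mu>\<^sub>1 > 0\<close> \<open>T > 0\<close> \<open>\<nu>\<^sub>0 > 0\<close> K\<^sub>1 dt
        by (intro step_size_absorption[where q = "3 / 2" and T = T])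
          (auto simp: power2_eq_square mult.assoc)
      moreover have "\<delta>\<^sub>1 \<le> \<nu>\<^sub>0 / 20" unfolding \<delta>\<^sub>1_def by (simp add: min_le_iff_disj del: le_divide_eq_numeral1)
      ultimately show ?thesis by linarith
    qed

    \<comment> \<open>Stability of the coarse solution\<close>
    let ?F = "\<lambda>j. dt * (\<Sum>i=1..j. (l2_norm \<Omega> (f (real i * dt)))\<^sup>2)"
    let ?P = "(l2_norm \<Omega> (U\<^sub>h 0))\<^sup>2 + (l2_norm \<Omega> (U\<^sub>H 0))\<^sup>2 + ?F n"
    have F: "0 \<le> ?F j" for j using dt by (simp add: sum_nonneg)
    have P: "0 \<le> ?P" using F[of n] by (intro add_nonneg_nonneg) auto
    \<comment> \<open>The data up to step \<open>j\<close> are dominated by those up to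
      \<open>n\<close>, so one quantity \<open>?P\<close> bounds all steps
      \<open>j \<le> n\<close>.\<close>
    have Fmono: "?F j \<le> ?F n" if "j \<le> n" for j
      using dt that by (intro mult_left_mono sum_mono2) auto
    have coarse: "(l2_norm \<Omega> (U\<^sub>H j))\<^sup>2 \<le> C\<^sub>0 * ?P" if j: "j \<in> {1..n}" for j
    proof -
      have "(l2_norm \<Omega> (U\<^sub>H j))\<^sup>2 \<le> (l2_norm \<Omega> (U\<^sub>H j))\<^sup>2
          + (\<Sum>i=1..j. (l2_norm \<Omega> (\<lambda>x. U\<^sub>H i x - U\<^sub>H (i - 1) x))\<^sup>2)
          + \<nu>\<^sub>0 / 20 * (dt * (\<Sum>i=1..j. (h1_norm \<Omega> (U\<^sub>H i))\<^sup>2))"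
        using dt \<open>\<nu>\<^sub>0 > 0\<close> by (simp add: sum_nonneg)
      also have "\<dots> \<le> C\<^sub>0 * ((l2_norm \<Omega> (U\<^sub>H 0))\<^sup>2 + ?F j + 0)"
        unfolding C\<^sub>0_def
      proof (rule scheme_stability[OF sH VH, where \<mu>' = 0 and \<nu> = \<nu>\<^sub>0])
        show "\<bar>Bt_form \<Omega> \<alpha> \<beta> \<gamma> g (U\<^sub>H i) (U\<^sub>H i) v\<bar> \<le> \<mu>\<^sub>0 * h1_norm \<Omega> (U\<^sub>H i) * h1_norm \<Omega> v
            + 0 * l2_norm \<Omega> (U\<^sub>H i) * h1_norm \<Omega> v" if "i \<in> {1..N}" "v \<in> S H" for i v
        proof -
          have "U\<^sub>H i \<in> H10 \<Omega>" "v \<in> H10 \<Omega>" using UH VH that by auto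
          from assms(12)[OF this] show ?thesis by (simp add: B_form_def)
        qed
        show "\<nu>\<^sub>0 * (h1_norm \<Omega> v)\<^sup>2 \<le> A_form \<Omega> a a\<^sub>0 t v v" if "t \<in> {0..T}" "v \<in> H10 \<Omega>" for t v
          using that by (rule assms(6))
        show "\<bar>\<omega> N m i\<bar> \<le> K\<^sub>1" if "1 \<le> i" "i \<le> m" "m \<le> N" for m i
          using that by (rule assms(18))
        show "f t \<in> L2 \<Omega>" if "t \<in> {0..T}" for t using f that by blast
        show "dt * (K\<^sub>1 * \<mu>\<^sub>0) \<le> \<nu>\<^sub>0 - \<nu>\<^sub>0 / 20" by (rule small0)
      qed (use \<open>\<nu>\<^sub>0 > 0\<close> K\<^sub>1 dt j n in simp_all)
      also have "\<dots> \<le> C\<^sub>0 * ?P"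
      proof (rule mult_left_mono)
        have "?F j \<le> ?F n" using j by (intro Fmono) simp
        then show "(l2_norm \<Omega> (U\<^sub>H 0))\<^sup>2 + ?F j + 0 \<le> ?P"
          using zero_le_power2[of "l2_norm \<Omega> (U\<^sub>h 0)"] by linarith
      qed (use C\<^sub>0 in simp)
      finally show ?thesis .
    qed

    \<comment> \<open>Stability of the fine solution\<close>
    let ?G = "(K\<^sub>1 * \<mu>\<^sub>2)\<^sup>2 * (C\<^sub>0 * ?P)"
    have fine: "(l2_norm \<Omega> (U\<^sub>h j))\<^sup>2
          + (\<Sum>i=1..j. (l2_norm \<Omega> (\<lambda>x. U\<^sub>h i x - U\<^sub>h (i - 1) x))\<^sup>2)
          + \<delta>\<^sub>1 * (dt * (\<Sum>i=1..j. (h1_norm \<Omega> (U\<^sub>h i))\<^sup>2)) \<le> Q * ?P" (is "?E \<le> _")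
      if j: "j \<in> {1..n}" for j
    proof -
      have "?E \<le> stability_const \<delta>\<^sub>1 T (K\<^sub>1 * \<mu>\<^sub>1) * ((l2_norm \<Omega> (U\<^sub>h 0))\<^sup>2 + ?F j + ?G)"
      proof (rule scheme_stability[OF sh Vh, where \<mu>' = \<mu>\<^sub>2 and \<nu> = \<nu>\<^sub>0])
        show "\<bar>Bt_form \<Omega> \<alpha> \<beta> \<gamma> g (U\<^sub>H i) (U\<^sub>h i) v\<bar> \<le> \<mu>\<^sub>1 * h1_norm \<Omega> (U\<^sub>h i) * h1_norm \<Omega> v
            + \<mu>\<^sub>2 * l2_norm \<Omega> (U\<^sub>H i) * h1_norm \<Omega> v" if "i \<in> {1..N}" "v \<in> S h" for i v
        proof (rule assms(13))
          show "U\<^sub>H i \<in> H10 \<Omega>" "U\<^sub>h i \<in> H10 \<Omega>" "v \<in> H10 \<Omega>" using UH Uh Vh that by auto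
        qed
        show "0 \<le> ?G" using P C\<^sub>0 by (intro mult_nonneg_nonneg) auto
        show "(K\<^sub>1 * \<mu>\<^sub>2 * l2_norm \<Omega> (U\<^sub>H i))\<^sup>2 \<le> ?G" if "i \<in> {1..j}" for i
          unfolding power_mult_distrib[of "K\<^sub>1 * \<mu>\<^sub>2" "l2_norm \<Omega> (U\<^sub>H i)"]
          using coarse that j by (intro mult_left_mono) auto
        show "\<nu>\<^sub>0 * (h1_norm \<Omega> v)\<^sup>2 \<le> A_form \<Omega> a a\<^sub>0 t v v" if "t \<in> {0..T}" "v \<in> H10 \<Omega>" for t v
          using that by (rule assms(6))
        show "\<bar>\<omega> N m i\<bar> \<le> K\<^sub>1" if "1 \<le> i" "i \<le> m" "m \<le> N" for m i
          using that by (rule assms(18))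
        show "f t \<in> L2 \<Omega>" if "t \<in> {0..T}" for t using f that by blast
        show "dt * (K\<^sub>1 * \<mu>\<^sub>1) \<le> \<nu>\<^sub>0 - \<delta>\<^sub>1" by (rule small1)
      qed (use K\<^sub>1 dt \<delta>\<^sub>1 j n in simp_all)
      also have "\<dots> \<le> stability_const \<delta>\<^sub>1 T (K\<^sub>1 * \<mu>\<^sub>1) * (?P + ?G)"
      proof (rule mult_left_mono)
        have "?F j \<le> ?F n" using j by (intro Fmono) simp
        then show "(l2_norm \<Omega> (U\<^sub>h 0))\<^sup>2 + ?F j + ?G \<le> ?P + ?G"
          using zero_le_power2[of "l2_norm \<Omega> (U\<^sub>H 0)"] by linarith
      qed (use st1 in simp)
      also have "\<dots> = Q * ?P" unfolding Q_def by (simp add: algebra_simps)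
      finally show ?thesis .
    qed

    \<comment> \<open>From squared energies to the three norms\<close>
    let ?R = "sqrt (Q * ?P)"
    have sums: "0 \<le> (\<Sum>i=1..j. (l2_norm \<Omega> (\<lambda>x. U\<^sub>h i x - U\<^sub>h (i - 1) x))\<^sup>2)"
      "0 \<le> \<delta>\<^sub>1 * (dt * (\<Sum>i=1..j. (h1_norm \<Omega> (U\<^sub>h i))\<^sup>2))" for j
      using dt \<delta>\<^sub>1 by (simp_all add: sum_nonneg)
    have "n \<in> {1..n}" using n by simp
    note fine_n = fine[OF this]
    have "(SUP i\<in>{1..n}. l2_norm \<Omega> (U\<^sub>h i)) \<le> ?R"
    \<comment> \<open>The energy at step \<open>n\<close> contains only the L2 norm of the last
      iterate, so each \<open>i\<close> uses the estimate stopped at \<open>i\<close>.\<close>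
    proof (rule cSUP_least)
      fix i assume "i \<in> {1..n}"
      then have "(l2_norm \<Omega> (U\<^sub>h i))\<^sup>2 \<le> Q * ?P" using fine[of i] sums[of i] by linarith
      then show "l2_norm \<Omega> (U\<^sub>h i) \<le> ?R" by (rule real_le_rsqrt)
    qed (use n in auto)
    moreover have "sqrt (\<Sum>i=1..n. (l2_norm \<Omega> (\<lambda>x. U\<^sub>h i x - U\<^sub>h (i - 1) x))\<^sup>2) \<le> ?R"
    proof (rule real_sqrt_le_mono)
      show "(\<Sum>i=1..n. (l2_norm \<Omega> (\<lambda>x. U\<^sub>h i x - U\<^sub>h (i - 1) x))\<^sup>2) \<le> Q * ?P"
        using fine_n sums[of n] zero_le_power2[of "l2_norm \<Omega> (U\<^sub>h n)"] by linarith
    qed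
    moreover have "sqrt \<nu>\<^sub>0 / 2 * sqrt (\<Sum>i=1..n. dt * (h1_norm \<Omega> (U\<^sub>h i))\<^sup>2)
        \<le> sqrt \<nu>\<^sub>0 / 2 * (sqrt (1 / \<delta>\<^sub>1) * ?R)"
    proof -
      have "\<delta>\<^sub>1 * (dt * (\<Sum>i=1..n. (h1_norm \<Omega> (U\<^sub>h i))\<^sup>2)) \<le> Q * ?P"
        using fine_n sums[of n] zero_le_power2[of "l2_norm \<Omega> (U\<^sub>h n)"] by linarith
      then have "(\<Sum>i=1..n. dt * (h1_norm \<Omega> (U\<^sub>h i))\<^sup>2) \<le> 1 / \<delta>\<^sub>1 * (Q * ?P)"
        using \<delta>\<^sub>1 by (simp add: sum_distrib_left[symmetric] pos_le_divide_eq mult.commute)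
      then show ?thesis
        unfolding real_sqrt_mult[symmetric, of "1 / \<delta>\<^sub>1"]
        using \<open>\<nu>\<^sub>0 > 0\<close> by (intro mult_left_mono real_sqrt_le_mono) auto
    qed
    moreover have "C * sqrt ?P = ?R + ?R + sqrt \<nu>\<^sub>0 / 2 * (sqrt (1 / \<delta>\<^sub>1) * ?R)"
      unfolding C_def real_sqrt_mult[of Q] by (simp add: algebra_simps)
    ultimately show ?thesis by linarith
  qed
  show ?thesis by (intro exI[of _ C] conjI C allI impI ballI) (rule bound)
qed

end
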